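(* Let $\{X_n\}_{n=1}^{\infty}$ be a sequence of random variables with common marginal distribution function $F$ that has periodic dependence. Let $\{x_n\}$ be a sequence of real numbers with $n\bar F(x_n)\to\tau$ for some $\tau>0$, suppose $\{X_n\}$ satisfies AIM$(x_n)$ with associated sequences $q_n$ and $\alpha_n$, and let $p_n$ be a sequence of positive integers with $p_n=o(n)$, $n\alpha_n=o(p_n)$ and $q_n=o(p_n)$. Suppose that for each $\tau'$ with $0<\tau'\le\tau$, $y_n=y_n(\tau')$ is a sequence of real numbers such that $n\bar F(y_n(\tau'))\to\tau'$. Then there exist constants $\gamma$ and $\gamma'$ with $0\le\gamma\le\gamma'\le1$ such that $$\limsup_{n\to\infty}\mathbb{P}\{M_n\le y_n(\tau')\}=e^{-\tau'\gamma},\qquad \liminf_{n\to\infty}\mathbb{P}\{M_n\le y_n(\tau')\}=e^{-\tau'\gamma'}$$ for all $0<\tau'\le\tau$. Hence if $\mathbb{P}\{M_n\le y_n(\tau')\}$ converges for some $\tau'$ with $0<\tau'\le\tau$, then $\gamma=\gamma'$ and $\mathbb{P}\{M_n\le y_n(\tau')\}\to e^{-\tau'\gamma}$ for all such $\tau'$.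
   Context: Notation: $\bar F=1-F$; $M_n=\max\{X_1,\dots,X_n\}$; for a set $A$ of positive integers, $M(A)=\max\{X_i:i\in A\}$ and $|A|$ is its number of elements. An interval is a set of consecutive integers. Limits and $o(\cdot)$ are as $n\to\infty$. Periodic dependence: a sequence $\{X_n\}$ with common marginal distributions has periodic dependence if there is $d\in\mathbb{N}=\{1,2,\dots\}$ such that $(X_{t_1},\dots,X_{t_k})$ and $(X_{t_1+d},\dots,X_{t_k+d})$ are equal in distribution for all $k$ and all $t_1,\dots,t_k\in\mathbb{N}$. AIM$(x_n)$ (asymptotic independence of maxima relative to $x_n$): there is a sequence $q_n$ of positive integers with $q_n=o(n)$ such that $$\alpha_n=\max\big|\mathbb{P}(M(I_1\cup I_2)\le x_n)-\mathbb{P}(M(I_1)\le x_n)\,\mathbb{P}(M(I_2)\le x_n)\big|\to 0,$$ where the maximum is over all pairs of intervals of positive integers $I_1=\{i_1,\dots,i_j\}$ and $I_2=\{i_j+q_n+1,\dots,i_j+q_n+k\}$ (so separated by $q_n$ intermediate integers) with $|I_1|\ge q_n$, $|I_2|\ge q_n$ and $i_j+q_n+k\le n$. *)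

theory Defs
  imports "HOL-Probability.Probability" "HOL-Library.Landau_Symbols"
begin

text \<open>Sequences indexed by the positive integers are functions on \<^typ>\<open>nat\<close> whose value
  at \<open>0\<close> is never constrained.\<close>

definition max_over :: "(nat \<Rightarrow> 'a \<Rightarrow> real) \<Rightarrow> nat set \<Rightarrow> 'a \<Rightarrow> real" where
  "max_over X A \<omega> = Max ((\<lambda>i. X i \<omega>) ` A)"

definition periodic_dependence :: "'a measure \<Rightarrow> (nat \<Rightarrow> 'a \<Rightarrow> real) \<Rightarrow> bool" where
  "periodic_dependence M X \<longleftrightarrow>
     (\<exists>d\<ge>1. \<forall>k. \<forall>t :: nat \<Rightarrow> nat. (\<forall>i\<in>{1..k}. t i \<ge> 1) \<longrightarrow>
        distr M (\<Pi>\<^sub>M i\<in>{1..k}. borel) (\<lambda>\<omega>. \<lambda>i\<in>{1..k}. X (t i) \<omega>) =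
        distr M (\<Pi>\<^sub>M i\<in>{1..k}. borel) (\<lambda>\<omega>. \<lambda>i\<in>{1..k}. X (t i + d) \<omega>))"

definition separated_intervals :: "nat \<Rightarrow> nat \<Rightarrow> (nat set \<times> nat set) set" where
  "separated_intervals q n =
     {(I1, I2). \<exists>a b k. 1 \<le> a \<and> a \<le> b \<and> 1 \<le> k \<and>
        I1 = {a..b} \<and> I2 = {b + q + 1..b + q + k} \<and>
        card I1 \<ge> q \<and> card I2 \<ge> q \<and> b + q + k \<le> n}"

text \<open>Inserting \<open>0\<close> only matters when no admissible pair exists, which is the case for at most
  finitely many \<open>n\<close> if \<open>q n = o(n)\<close>; otherwise the maximum is unchanged, being taken
  over nonnegative numbers.\<close>

definition aim_coeff ::
  "'a measure \<Rightarrow> (nat \<Rightarrow> 'a \<Rightarrow> real) \<Rightarrow> (nat \<Rightarrow> real) \<Rightarrow> (nat \<Rightarrow> nat) \<Rightarrow> nat \<Rightarrow> real" where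
  "aim_coeff M X x q n = Max (insert 0
     ((\<lambda>(I1, I2). \<bar>\<P>(\<omega> in M. max_over X (I1 \<union> I2) \<omega> \<le> x n)
                   - \<P>(\<omega> in M. max_over X I1 \<omega> \<le> x n) * \<P>(\<omega> in M. max_over X I2 \<omega> \<le> x n)\<bar>)
      ` separated_intervals (q n) n))"

text \<open>AIM relative to \<open>x\<close> with the witnessing sequence \<open>q\<close> made explicit; the property
  itself is \<open>\<exists>q. AIM_with M X x q\<close>.\<close>

definition AIM_with ::
  "'a measure \<Rightarrow> (nat \<Rightarrow> 'a \<Rightarrow> real) \<Rightarrow> (nat \<Rightarrow> real) \<Rightarrow> (nat \<Rightarrow> nat) \<Rightarrow> bool" where
  "AIM_with M X x q \<longleftrightarrow>
     (\<forall>n\<ge>1. q n > 0) \<and> (\<lambda>n. real (q n)) \<in> o(\<lambda>n. real n) \<and> aim_coeff M X x q \<longlonglongrightarrow> 0"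

end

theory Submission
  imports Defs
begin

text \<open>
  Write \<open>b n = P(M_n \<le> x n)\<close>. The theorem reduces to one statement about the levels
  \<open>x n\<close> alone: for every real \<open>\<theta>\<close> with \<open>0 < \<theta> \<le> 1\<close>,
  the probability that the first \<open>\<lfloor>\<theta> n\<rfloor>\<close> variables
  stay below \<open>x n\<close> differs from \<open>b n powr \<theta>\<close> by a null sequence
  (\<open>no_exceedance_fraction_powr\<close>).

  To prove it, fix \<open>k\<close> and cut \<open>{1..n}\<close> into \<open>k\<close> blocks of the same length
  \<open>r\<close>, a multiple of the period. By periodicity all blocks have the same probability
  \<open>g\<close> of staying below \<open>x n\<close>. Deleting \<open>q n\<close> indices at the end of a block changes
  probabilities by at most \<open>q n * (1 - F (x n))\<close>, which tends to \<open>0\<close> because \<open>q n = o(n)\<close> and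
  \<open>n * (1 - F (x n))\<close> converges; after the deletion, asymptotic independence applies, so that \<open>j\<close> blocks stay
  below with probability close to \<open>g ^ j\<close> (\<open>no_exceedance_blocks\<close>). Since \<open>k\<close> is
  fixed, only boundedly many errors add up. In particular \<open>b n\<close> is close to \<open>g ^ k\<close>, while
  \<open>\<lfloor>\<theta> n\<rfloor>\<close> indices make up about
  \<open>\<theta> k\<close> blocks. Rounding \<open>\<theta> k\<close> to an integer costs
  one block, that is about \<open>\<tau> / k\<close>, which is arbitrarily small.

  The statement with \<open>\<theta> = 1 / k\<close> and the union bound give
  \<open>b n powr (1 / k) \<ge> 1 - \<tau> / k - o(1)\<close>, hence
  \<open>liminf b \<ge> lim (1 - \<tau> / k) ^ k = exp (- \<tau>)\<close>
  (\<open>liminf_no_exceedance_ge\<close>). This makes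
  \<open>\<gamma> = - ln (limsup b) / \<tau>\<close> and
  \<open>\<gamma>' = - ln (liminf b) / \<tau>\<close> lie in \<open>[0, 1]\<close>.

  For an intensity \<open>\<tau>' \<le> \<tau>\<close> take \<open>\<theta> = \<tau>' / \<tau>\<close>
  and \<open>m = \<lfloor>\<theta> n\<rfloor>\<close>. Both \<open>m * (1 - F (y m))\<close> and
  \<open>m * (1 - F (x n))\<close> tend to \<open>\<tau>'\<close>, so the levels \<open>y m\<close> and \<open>x n\<close> are
  interchangeable for \<open>m\<close> variables, and \<open>P(M_m \<le> y m)\<close> is close to
  \<open>b n powr \<theta>\<close>. As \<open>n\<close> runs through the naturals, \<open>m\<close> runs through all of
  them too, because \<open>\<theta> \<le> 1\<close>; so passing from \<open>n\<close> to \<open>m\<close> preserves upper and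
  lower limits, and these are the corresponding limits of \<open>b\<close> raised to the power
  \<open>\<theta>\<close> (\<open>limsup_liminf_no_exceedance_level\<close>).
\<close>

section \<open>Probabilities of no exceedance\<close>

locale common_marginals = prob_space M for M :: "'a measure" +
  fixes X :: "nat \<Rightarrow> 'a \<Rightarrow> real" and F :: "real \<Rightarrow> real"
  assumes X_measurable: "\<And>i. i \<ge> 1 \<Longrightarrow> X i \<in> borel_measurable M"
    and X_cdf: "\<And>i. i \<ge> 1 \<Longrightarrow> cdf (distr M borel (X i)) = F"
begin

text \<open>For finite nonempty \<open>A\<close> this is the distribution function of the maximum over \<open>A\<close>. It is stated
  with a bounded quantifier, which gives the empty set of indices the value \<open>1\<close> where the maximum is
  unspecified.\<close>

definition no_exceedance :: "real \<Rightarrow> nat set \<Rightarrow> real" where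
  "no_exceedance t A = prob {\<omega> \<in> space M. \<forall>i\<in>A. X i \<omega> \<le> t}"

lemma no_exceedance_event:
  assumes "finite A" "A \<subseteq> {1..}"
  shows "{\<omega> \<in> space M. \<forall>i\<in>A. X i \<omega> \<le> t} \<in> events"
proof -
  have [measurable]: "\<And>i. i \<in> A \<Longrightarrow> X i \<in> borel_measurable M"
    using assms X_measurable by auto
  show ?thesis using assms(1) by measurable
qed

lemma prob_max_over_le:
  assumes "finite A" "A \<noteq> {}"
  shows "\<P>(\<omega> in M. max_over X A \<omega> \<le> t) = no_exceedance t A"
  using assms by (simp add: max_over_def no_exceedance_def)

lemma no_exceedance_bounds: "0 \<le> no_exceedance t A" "no_exceedance t A \<le> 1"
  by (auto simp: no_exceedance_def)

lemma no_exceedance_empty [simp]: "no_exceedance t {} = 1"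
  by (simp add: no_exceedance_def prob_space)

lemma prob_X_le:
  assumes "i \<ge> 1"
  shows "prob {\<omega> \<in> space M. X i \<omega> \<le> t} = F t"
proof -
  have "F t = measure (distr M borel (X i)) {..t}"
    by (simp add: cdf_def flip: X_cdf[OF assms])
  also have "\<dots> = prob (X i -` {..t} \<inter> space M)"
    using X_measurable[OF assms] by (simp add: measure_distr)
  also have "X i -` {..t} \<inter> space M = {\<omega> \<in> space M. X i \<omega> \<le> t}" by auto
  finally show ?thesis by simp
qed

lemma F_le_1: "F t \<le> 1"
  using prob_X_le[of 1 t] prob_le_1 by (metis le_refl)

lemma prob_X_between:
  assumes "i \<ge> 1" "s \<le> t"
  shows "prob {\<omega> \<in> space M. s < X i \<omega> \<and> X i \<omega> \<le> t} = F t - F s"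
proof -
  have [measurable]: "X i \<in> borel_measurable M" using X_measurable assms by auto
  have "{\<omega> \<in> space M. s < X i \<omega> \<and> X i \<omega> \<le> t} =
      {\<omega> \<in> space M. X i \<omega> \<le> t} - {\<omega> \<in> space M. X i \<omega> \<le> s}" by auto
  also have "prob \<dots> = F t - F s"
    using assms by (subst finite_measure_Diff) (auto simp: prob_X_le)
  finally show ?thesis .
qed

lemma prob_X_gt:
  assumes "i \<ge> 1"
  shows "prob {\<omega> \<in> space M. t < X i \<omega>} = 1 - F t"
proof -
  have [measurable]: "X i \<in> borel_measurable M" using X_measurable assms by auto
  have "{\<omega> \<in> space M. t < X i \<omega>} = space M - {\<omega> \<in> space M. X i \<omega> \<le> t}" by auto
  also have "prob \<dots> = 1 - F t"
    using assms by (subst prob_compl) (auto simp: prob_X_le)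
  finally show ?thesis .
qed

lemma no_exceedance_antimono:
  assumes "finite B" "B \<subseteq> {1..}" "A \<subseteq> B"
  shows "no_exceedance t B \<le> no_exceedance t A"
  unfolding no_exceedance_def
  using assms by (intro finite_measure_mono no_exceedance_event) (auto dest: finite_subset)

text \<open>Union bound: if the variables in \<open>A\<close> stay below \<open>t\<close> but those in \<open>B\<close> do not, then
  some variable indexed by \<open>B - A\<close> exceeds \<open>t\<close>. Every change of index set below is estimated this way.\<close>

lemma no_exceedance_subset_le:
  assumes "finite B" "B \<subseteq> {1..}" "A \<subseteq> B"
  shows "no_exceedance t A \<le> no_exceedance t B + real (card (B - A)) * (1 - F t)"
proof -
  have fin: "finite A" "finite (B - A)" using assms finite_subset by auto
  have ev: "{\<omega> \<in> space M. t < X i \<omega>} \<in> events" if "i \<in> B - A" for i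
  proof -
    have [measurable]: "X i \<in> borel_measurable M" using X_measurable that assms by auto
    show ?thesis by measurable
  qed
  have "no_exceedance t A \<le> prob ({\<omega> \<in> space M. \<forall>i\<in>B. X i \<omega> \<le> t} \<union>
          (\<Union>i\<in>B - A. {\<omega> \<in> space M. t < X i \<omega>}))"
    unfolding no_exceedance_def
    using assms ev fin by (intro finite_measure_mono sets.Un sets.finite_UN no_exceedance_event)
      (auto simp: not_less)
  also have "\<dots> \<le> no_exceedance t B + prob (\<Union>i\<in>B - A. {\<omega> \<in> space M. t < X i \<omega>})"
    unfolding no_exceedance_def
    using assms ev fin by (intro measure_Un_le sets.finite_UN no_exceedance_event) auto
  also have "prob (\<Union>i\<in>B - A. {\<omega> \<in> space M. t < X i \<omega>}) \<le>
      (\<Sum>i\<in>B - A. prob {\<omega> \<in> space M. t < X i \<omega>})"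
    using ev fin by (intro finite_measure_subadditive_finite) auto
  also have "\<dots> = (\<Sum>i\<in>B - A. 1 - F t)"
    using assms by (intro sum.cong prob_X_gt) auto
  finally show ?thesis by simp
qed

lemma no_exceedance_level_le:
  assumes "finite A" "A \<subseteq> {1..}" "s \<le> t"
  shows "no_exceedance s A \<le> no_exceedance t A"
    and "no_exceedance t A \<le> no_exceedance s A + real (card A) * (F t - F s)"
proof -
  show "no_exceedance s A \<le> no_exceedance t A"
    unfolding no_exceedance_def
    using assms by (intro finite_measure_mono no_exceedance_event) (auto intro: order_trans)
  have ev: "{\<omega> \<in> space M. s < X i \<omega> \<and> X i \<omega> \<le> t} \<in> events" if "i \<in> A" for i
  proof -
    have [measurable]: "X i \<in> borel_measurable M" using X_measurable that assms by auto
    show ?thesis by measurable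
  qed
  have "no_exceedance t A \<le> prob ({\<omega> \<in> space M. \<forall>i\<in>A. X i \<omega> \<le> s} \<union>
          (\<Union>i\<in>A. {\<omega> \<in> space M. s < X i \<omega> \<and> X i \<omega> \<le> t}))"
    unfolding no_exceedance_def
    using assms ev by (intro finite_measure_mono sets.Un sets.finite_UN no_exceedance_event)
      (auto simp: not_less)
  also have "\<dots> \<le> no_exceedance s A + prob (\<Union>i\<in>A. {\<omega> \<in> space M. s < X i \<omega> \<and> X i \<omega> \<le> t})"
    unfolding no_exceedance_def
    using assms ev by (intro measure_Un_le sets.finite_UN no_exceedance_event) auto
  also have "prob (\<Union>i\<in>A. {\<omega> \<in> space M. s < X i \<omega> \<and> X i \<omega> \<le> t}) \<le>
      (\<Sum>i\<in>A. prob {\<omega> \<in> space M. s < X i \<omega> \<and> X i \<omega> \<le> t})"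
    using ev assms by (intro finite_measure_subadditive_finite) auto
  also have "\<dots> = (\<Sum>i\<in>A. F t - F s)"
    using assms by (intro sum.cong prob_X_between) auto
  finally show "no_exceedance t A \<le> no_exceedance s A + real (card A) * (F t - F s)" by simp
qed

text \<open>The two events differ only if some variable falls between the two levels.\<close>

lemma no_exceedance_level_dist:
  assumes "finite A" "A \<subseteq> {1..}"
  shows "\<bar>no_exceedance t A - no_exceedance s A\<bar> \<le> real (card A) * \<bar>F t - F s\<bar>"
proof (cases "s \<le> t")
  case True
  with no_exceedance_level_le[OF assms True] mult_left_mono[of "F t - F s" "\<bar>F t - F s\<bar>" "real (card A)"]
  show ?thesis by simp linarith
next
  case False
  then have "t \<le> s" by simp
  with no_exceedance_level_le[OF assms this] mult_left_mono[of "F s - F t" "\<bar>F t - F s\<bar>" "real (card A)"]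
  show ?thesis by simp linarith
qed

text \<open>Puts the probability in terms of the finite-dimensional distributions that the definition of
  periodic dependence compares.\<close>

lemma no_exceedance_as_distr:
  assumes "\<And>i. i \<in> {1..k} \<Longrightarrow> s i \<ge> (1::nat)"
  shows "measure (distr M (\<Pi>\<^sub>M i\<in>{1..k}. borel) (\<lambda>\<omega>. \<lambda>i\<in>{1..k}. X (s i) \<omega>)) (\<Pi>\<^sub>E i\<in>{1..k}. {..t})
    = no_exceedance t (s ` {1..k::nat})"
proof -
  have meas: "(\<lambda>\<omega>. \<lambda>i\<in>{1..k}. X (s i) \<omega>) \<in> measurable M (\<Pi>\<^sub>M i\<in>{1..k}. borel)"
    using assms X_measurable by (intro measurable_restrict) auto
  have "(\<lambda>\<omega>. \<lambda>i\<in>{1..k}. X (s i) \<omega>) -` (\<Pi>\<^sub>E i\<in>{1..k}. {..t}) \<inter> space M =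
      {\<omega> \<in> space M. \<forall>i\<in>s ` {1..k}. X i \<omega> \<le> t}"
    by (auto simp: PiE_iff)
  then show ?thesis
    unfolding no_exceedance_def
    by (subst measure_distr[OF meas]) (auto intro!: sets_PiM_I_finite)
qed

text \<open>Equality for shifts by one period suffices: shifts by \<open>l\<close> periods follow by iteration.\<close>

lemma no_exceedance_shift:
  assumes per: "\<And>k t. \<forall>i\<in>{1..k}. t i \<ge> 1 \<Longrightarrow>
        distr M (\<Pi>\<^sub>M i\<in>{1..k}. borel) (\<lambda>\<omega>. \<lambda>i\<in>{1..k}. X (t i) \<omega>) =
        distr M (\<Pi>\<^sub>M i\<in>{1..k::nat}. borel) (\<lambda>\<omega>. \<lambda>i\<in>{1..k}. X (t i + d) \<omega>)"
  shows "no_exceedance t {l * d + 1..l * d + r} = no_exceedance t {1..r}"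
proof (induction l)
  case (Suc l)
  have img: "(\<lambda>i. c + i) ` {1..r} = {c + 1..c + r}" for c
    by (simp add: image_add_atLeastAtMost)
  have "no_exceedance t {l * d + 1..l * d + r} = no_exceedance t ((\<lambda>i. l * d + i) ` {1..r})"
    by (simp only: img)
  also have "\<dots> = no_exceedance t ((\<lambda>i. (l * d + i) + d) ` {1..r})"
    using per[of r "\<lambda>i. l * d + i"] by (subst (1 2) no_exceedance_as_distr[symmetric]) simp_all
  also have "(\<lambda>i. (l * d + i) + d) ` {1..r} = {Suc l * d + 1..Suc l * d + r}"
    using img[of "Suc l * d"] by (simp add: algebra_simps)
  finally show ?case using Suc by simp
qed simp

section \<open>Splitting into blocks\<close>

lemma finite_separated_intervals: "finite (separated_intervals q n)"
proof (rule finite_subset)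
  show "separated_intervals q n \<subseteq> Pow {..n} \<times> Pow {..n}"
    by (auto simp: separated_intervals_def)
qed simp

lemma aim_coeff_nonneg: "aim_coeff M X x q n \<ge> 0"
  unfolding aim_coeff_def using finite_separated_intervals by (intro Max_ge) auto

text \<open>Replaces the maximum in the mixing coefficient by the bound that it provides on each
  admissible pair of intervals.\<close>

lemma aim_coeff_bound:
  assumes "1 \<le> a" "a \<le> b" "1 \<le> k" "q n \<le> Suc b - a" "q n \<le> k" "b + q n + k \<le> n"
  shows "\<bar>no_exceedance (x n) ({a..b} \<union> {b + q n + 1..b + q n + k}) -
      no_exceedance (x n) {a..b} * no_exceedance (x n) {b + q n + 1..b + q n + k}\<bar>
    \<le> aim_coeff M X x q n"
proof -
  let ?I = "{a..b}" and ?J = "{b + q n + 1..b + q n + k}"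
  have "(?I, ?J) \<in> separated_intervals (q n) n"
    unfolding separated_intervals_def mem_Collect_eq prod.case using assms
    by (intro exI[of _ a] exI[of _ b] exI[of _ k]) simp
  then have "\<bar>\<P>(\<omega> in M. max_over X (?I \<union> ?J) \<omega> \<le> x n)
                   - \<P>(\<omega> in M. max_over X ?I \<omega> \<le> x n) * \<P>(\<omega> in M. max_over X ?J \<omega> \<le> x n)\<bar>
    \<le> aim_coeff M X x q n"
    unfolding aim_coeff_def using finite_separated_intervals
    by (intro Max_ge) (auto intro!: image_eqI[where x = "(?I, ?J)"])
  then show ?thesis
    using assms by (subst (asm) (1 2 3) prob_max_over_le) auto
qed

text \<open>Induction on the number of blocks. To split off the last block, the \<open>q n\<close> indices before it
  are removed, the two remaining separated intervals are decoupled, and the removed indices are put back; removal and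
  restoration each cost at most \<open>q n * (1 - F (x n))\<close>. The error of the first \<open>j\<close> blocks is not
  enlarged, as it is multiplied by a probability. The bound \<open>2 * q n \<le> r\<close> keeps the shortened
  interval at least \<open>q n\<close> long.\<close>

lemma no_exceedance_blocks:
  assumes shift: "\<And>l. no_exceedance (x n) {l * r + 1..l * r + r} = no_exceedance (x n) {1..r}"
    and "r \<ge> 1" "2 * q n \<le> r" "j * r \<le> n"
  shows "\<bar>no_exceedance (x n) {1..j * r} - no_exceedance (x n) {1..r} ^ j\<bar>
    \<le> real j * (aim_coeff M X x q n + 2 * (real (q n) * (1 - F (x n))))"
  using assms(4)
proof (induction j)
  case (Suc j)
  let ?G = "no_exceedance (x n)" and ?g = "no_exceedance (x n) {1..r}"
  let ?\<alpha> = "aim_coeff M X x q n" and ?e = "real (q n) * (1 - F (x n))"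
  have e: "?e \<ge> 0" using F_le_1[of "x n"] by simp
  show ?case
  proof (cases "j = 0")
    case True
    then show ?thesis using aim_coeff_nonneg e by simp
  next
    case False
    have jr: "r \<le> j * r" using False by simp
    let ?I = "{1..j * r - q n}" and ?J = "{j * r + 1..j * r + r}"
    \<comment> \<open>The gap between the two intervals consists of the last \<open>q n\<close> indices of block \<open>j\<close>.\<close>
    have blk: "?G ?J = ?g" by (rule shift)
    have q_le: "q n \<le> j * r - q n" "1 \<le> j * r - q n"
      using jr assms by linarith+
    have aim: "\<bar>?G (?I \<union> ?J) - ?G ?I * ?G ?J\<bar> \<le> ?\<alpha>"
      using aim_coeff_bound[of 1 "j * r - q n" r q n x] q_le jr assms(2,3) Suc.prems
      by (simp add: algebra_simps)
    have diff: "{1..Suc j * r} - (?I \<union> ?J) \<subseteq> {j * r - q n + 1..j * r}" by auto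
    have card: "card ({1..Suc j * r} - (?I \<union> ?J)) \<le> q n"
      using card_mono[OF _ diff] jr assms by simp
    have card': "card ({1..j * r} - ?I) \<le> q n"
    proof -
      have "{1..j * r} - ?I \<subseteq> {j * r - q n + 1..j * r}" by auto
      from card_mono[OF _ this] show ?thesis using jr assms by simp
    qed
    have sub: "?I \<union> ?J \<subseteq> {1..Suc j * r}" by auto
    have "?G (?I \<union> ?J) \<le> ?G {1..Suc j * r} + real (card ({1..Suc j * r} - (?I \<union> ?J))) * (1 - F (x n))"
      using sub by (intro no_exceedance_subset_le) auto
    also have "\<dots> \<le> ?G {1..Suc j * r} + ?e"
      using card F_le_1[of "x n"] by (intro add_left_mono mult_right_mono) auto
    finally have 1: "?G (?I \<union> ?J) \<le> ?G {1..Suc j * r} + ?e" .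
    have 2: "?G {1..Suc j * r} \<le> ?G (?I \<union> ?J)"
      using sub by (intro no_exceedance_antimono) auto
    have "?G ?I \<le> ?G {1..j * r} + real (card ({1..j * r} - ?I)) * (1 - F (x n))"
      by (intro no_exceedance_subset_le) auto
    also have "\<dots> \<le> ?G {1..j * r} + ?e"
      using card' F_le_1[of "x n"] by (intro add_left_mono mult_right_mono) auto
    finally have 3: "?G ?I \<le> ?G {1..j * r} + ?e" .
    have 4: "?G {1..j * r} \<le> ?G ?I"
      by (intro no_exceedance_antimono) auto
    have g: "0 \<le> ?g" "?g \<le> 1" by (rule no_exceedance_bounds)+
    have 5: "\<bar>?G ?I * ?g - ?G {1..j * r} * ?g\<bar> \<le> ?e"
    proof -
      have "\<bar>?G ?I * ?g - ?G {1..j * r} * ?g\<bar> = \<bar>?G ?I - ?G {1..j * r}\<bar> * ?g"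
        using g by (simp add: abs_mult flip: left_diff_distrib)
      also have "\<dots> \<le> ?e * 1" using 3 4 g e by (intro mult_mono) auto
      finally show ?thesis by simp
    qed
    have 6: "\<bar>?G {1..j * r} * ?g - ?g ^ Suc j\<bar> \<le> real j * (?\<alpha> + 2 * ?e)"
    proof -
      have "\<bar>?G {1..j * r} * ?g - ?g ^ Suc j\<bar> = \<bar>?G {1..j * r} - ?g ^ j\<bar> * ?g"
        using g by (simp only: power_Suc2 left_diff_distrib[symmetric] abs_mult abs_of_nonneg)
      also have "\<dots> \<le> (real j * (?\<alpha> + 2 * ?e)) * 1"
        using Suc g aim_coeff_nonneg e by (intro mult_mono) auto
      finally show ?thesis by simp
    qed
    have "real (Suc j) * (?\<alpha> + 2 * ?e) = real j * (?\<alpha> + 2 * ?e) + (?\<alpha> + 2 * ?e)"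
      by (simp add: algebra_simps)
    then show ?thesis using 1 2 5 6 aim unfolding blk by linarith
  qed
qed simp


end

section \<open>Fractional powers and upper and lower limits\<close>

text \<open>The cost of rounding the number of blocks: changing the exponent by at most \<open>1\<close> changes the
  power by at most \<open>1 - g\<close>, uniformly in \<open>g\<close>.\<close>

lemma power_powr_diff_le:
  fixes g s :: real
  assumes "0 \<le> g" "g \<le> 1" "real j \<le> s" "s \<le> real j + 1"
  shows "\<bar>g ^ j - g powr s\<bar> \<le> 1 - g"
proof (cases "g = 0")
  case True
  then show ?thesis by (simp add: power_0_left)
next
  case False
  then have g: "g > 0" using assms by simp
  have "g powr s \<le> g ^ j" "g ^ j * g \<le> g powr s"
    using powr_mono'[of "real j" s g] powr_mono'[of s "real j + 1" g] assms g
    by (simp_all add: powr_realpow powr_add)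
  moreover have "g ^ j * (1 - g) \<le> 1 * (1 - g)"
    using assms by (intro mult_right_mono power_le_one) auto
  ultimately show ?thesis by (simp add: algebra_simps)
qed

lemma power_powr_eq:
  fixes g \<theta> :: real
  assumes "0 \<le> g" "k \<ge> 1"
  shows "(g ^ k) powr \<theta> = g powr (real k * \<theta>)"
proof (cases "g = 0")
  case False
  then show ?thesis using assms by (simp flip: powr_powr powr_realpow)
qed (use assms in simp)

text \<open>Neither sequence need converge; the power function is uniformly continuous on the unit
  interval.\<close>

lemma tendsto_powr_diff:
  fixes a b :: "nat \<Rightarrow> real"
  assumes "\<theta> > 0" "\<And>n. a n \<in> {0..1}" "\<And>n. b n \<in> {0..1}" "(\<lambda>n. a n - b n) \<longlonglongrightarrow> 0"
  shows "(\<lambda>n. a n powr \<theta> - b n powr \<theta>) \<longlonglongrightarrow> 0"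
proof -
  have "continuous_on {0..1} (\<lambda>u::real. u powr \<theta>)"
    using assms(1) by (intro continuous_on_powr' continuous_intros) auto
  then have "uniformly_continuous_on {0..1} (\<lambda>u::real. u powr \<theta>)"
    by (rule compact_uniformly_continuous) simp
  moreover have "(\<lambda>n. dist (a n) (b n)) \<longlonglongrightarrow> 0"
    using tendsto_rabs_zero[OF assms(4)] by (simp add: dist_real_def)
  ultimately have "(\<lambda>n. dist (a n powr \<theta>) (b n powr \<theta>)) \<longlonglongrightarrow> 0"
    using assms(2,3) unfolding uniformly_continuous_on_sequentially by blast
  then show ?thesis by (simp add: dist_real_def tendsto_rabs_zero_iff)
qed

text \<open>Upper and lower limits commute with continuous monotone maps of the extended reals. This is such
  an extension of the power function on the unit interval, obtained by clamping the argument.\<close>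

lemma ereal_powr_continuous_mono:
  fixes \<theta> :: real
  assumes "\<theta> > 0"
  defines "h \<equiv> \<lambda>e. ereal (real_of_ereal (max 0 (min 1 e)) powr \<theta>)"
  shows "continuous_on UNIV h" "mono h"
proof -
  have fin: "\<bar>max 0 (min 1 e)\<bar> \<noteq> \<infinity>" for e :: ereal
    by (cases e) (auto simp: max_def min_def)
  have nn: "0 \<le> real_of_ereal (max 0 (min 1 e))" for e
    by (simp add: real_of_ereal_pos)
  have "continuous_on UNIV (\<lambda>e. real_of_ereal (max 0 (min 1 e)))"
    using fin by (intro continuous_on_compose2[OF continuous_on_real] continuous_intros) auto
  then show "continuous_on UNIV h"
    unfolding h_def using assms(1) nn
    by (intro continuous_on_compose2[OF continuous_on_ereal] continuous_on_powr' continuous_intros)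
      (auto intro: continuous_on_id)
  show "mono h"
  proof
    fix e e' :: ereal
    assume "e \<le> e'"
    then have "max 0 (min 1 e) \<le> max 0 (min 1 e')" by (intro max.mono min.mono) auto
    then have "real_of_ereal (max 0 (min 1 e)) \<le> real_of_ereal (max 0 (min 1 e'))"
      using fin by (intro real_of_ereal_positive_mono) auto
    then show "h e \<le> h e'"
      unfolding h_def using nn assms(1) by (simp add: powr_mono2)
  qed
qed

lemma limsup_liminf_powr:
  fixes b :: "nat \<Rightarrow> real"
  assumes "\<theta> > 0" "\<And>n. b n \<in> {0..1}"
    and "limsup (\<lambda>n. ereal (b n)) = ereal u" "liminf (\<lambda>n. ereal (b n)) = ereal l"
    and "u \<in> {0..1}" "l \<in> {0..1}"
  shows "limsup (\<lambda>n. ereal (b n powr \<theta>)) = ereal (u powr \<theta>)"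
    and "liminf (\<lambda>n. ereal (b n powr \<theta>)) = ereal (l powr \<theta>)"
proof -
  let ?h = "\<lambda>e. ereal (real_of_ereal (max 0 (min 1 e)) powr \<theta>)"
  have h: "?h (ereal v) = ereal (v powr \<theta>)" if "v \<in> {0..1}" for v
    using that by (auto simp: min_def max_def one_ereal_def zero_ereal_def)
  have "(\<lambda>n. ereal (b n powr \<theta>)) = (\<lambda>n. ?h (ereal (b n)))"
    using h assms(2) by (intro ext) metis
  then show "limsup (\<lambda>n. ereal (b n powr \<theta>)) = ereal (u powr \<theta>)"
    "liminf (\<lambda>n. ereal (b n powr \<theta>)) = ereal (l powr \<theta>)"
    using Limsup_compose_continuous_mono[OF ereal_powr_continuous_mono[OF assms(1)], of sequentially "\<lambda>n. ereal (b n)"]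
      Liminf_compose_continuous_mono[OF ereal_powr_continuous_mono[OF assms(1)], of sequentially "\<lambda>n. ereal (b n)"]
      h[OF assms(5)] h[OF assms(6)] assms(3,4) by simp_all
qed

text \<open>For \<open>\<theta> \<le> 1\<close> the map
  \<open>n \<mapsto> \<lfloor>\<theta> n\<rfloor>\<close> moves by steps of at most one, so it reaches
  every natural number, at late times only the large ones. Hence nothing is lost in upper and lower limits along it.\<close>

lemma filtermap_floor_mult:
  fixes \<theta> :: real
  assumes "0 < \<theta>" "\<theta> \<le> 1"
  shows "filtermap (\<lambda>n. nat \<lfloor>\<theta> * real n\<rfloor>) sequentially = sequentially"
proof (rule antisym)
  let ?f = "\<lambda>n::nat. nat \<lfloor>\<theta> * real n\<rfloor>"
  have "filterlim ?f at_top sequentially"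
    using assms by (intro filterlim_compose[OF filterlim_nat_sequentially]
      filterlim_compose[OF filterlim_floor_sequentially]
      filterlim_tendsto_pos_mult_at_top[OF tendsto_const] filterlim_real_sequentially)
  then show "filtermap ?f sequentially \<le> sequentially" by (simp add: filterlim_def)
  show "sequentially \<le> filtermap ?f sequentially"
    unfolding le_filter_def eventually_filtermap
  proof (intro allI impI)
    fix P
    assume "eventually (\<lambda>n. P (?f n)) sequentially"
    then obtain N where N: "\<And>n. n \<ge> N \<Longrightarrow> P (?f n)"
      by (auto simp: eventually_sequentially)
    show "eventually P sequentially"
      unfolding eventually_sequentially
    proof (intro exI allI impI)
      fix n
      assume n: "N \<le> n"
      define m where "m = nat \<lceil>real n / \<theta>\<rceil>"
      have "0 \<le> real n / \<theta>" using assms by simp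
      then have m: "real n / \<theta> \<le> real m" "real m < real n / \<theta> + 1"
        unfolding m_def by linarith+
      have "\<theta> * (real n / \<theta>) \<le> \<theta> * real m" "\<theta> * real m < \<theta> * (real n / \<theta> + 1)"
        using m assms by (simp_all only: mult_le_cancel_left_pos mult_less_cancel_left_pos)
      then have "real n \<le> \<theta> * real m" "\<theta> * real m < real n + \<theta>"
        using assms by (simp_all add: distrib_left)
      then have "\<lfloor>\<theta> * real m\<rfloor> = int n" using assms by (intro floor_unique) auto
      moreover have "real n \<le> real n / \<theta>" using assms by (simp add: field_simps mult_left_le mult_left_le_one_le)
      then have "N \<le> m" using n m by linarith
      ultimately show "P n" using N[of m] by simp
    qed
  qed
qed

lemma limsup_liminf_floor_mult:
  fixes \<theta> :: real and f :: "nat \<Rightarrow> ereal"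
  assumes "0 < \<theta>" "\<theta> \<le> 1"
  shows "limsup (\<lambda>n. f (nat \<lfloor>\<theta> * real n\<rfloor>)) = limsup f"
    and "liminf (\<lambda>n. f (nat \<lfloor>\<theta> * real n\<rfloor>)) = liminf f"
proof -
  let ?g = "\<lambda>n::nat. nat \<lfloor>\<theta> * real n\<rfloor>"
  have "Limsup (filtermap ?g sequentially) f = limsup (\<lambda>n. f (?g n))"
    by (intro antisym) (auto simp: Limsup_le_iff eventually_filtermap dest: Limsup_lessD)
  moreover have "Liminf (filtermap ?g sequentially) f = liminf (\<lambda>n. f (?g n))"
    by (intro antisym) (auto simp: le_Liminf_iff eventually_filtermap dest: less_LiminfD)
  ultimately show "limsup (\<lambda>n. f (?g n)) = limsup f" "liminf (\<lambda>n. f (?g n)) = liminf f"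
    by (simp_all add: filtermap_floor_mult[OF assms])
qed


section \<open>Maxima up to a fraction of the time\<close>

context common_marginals
begin

text \<open>The witness \<open>a\<close> is \<open>g ^ k\<close>, where \<open>g\<close> is the probability of no exceedance in
  one of \<open>k\<close> equal blocks. It is close to the probability for all of \<open>{1..n}\<close>, up to the fewer than
  \<open>k * d\<close> indices left over. Of the \<open>\<lfloor>\<theta> n\<rfloor>\<close> first
  indices, \<open>j = \<lfloor>\<theta> k\<rfloor>\<close> full blocks are used, leaving over at most
  one block and \<open>k * d\<close> indices. That block, and replacing \<open>j\<close> by
  \<open>\<theta> k\<close> in the exponent of \<open>g\<close>, account for the two terms
  \<open>n * (1 - F (x n)) / k\<close>, the only ones that do not vanish as \<open>n\<close> grows.\<close>

lemma fraction_close_to_blocks: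
  fixes x :: "nat \<Rightarrow> real" and \<theta> :: real and d k n :: nat
  assumes shift: "\<And>t l r. no_exceedance t {l * d + 1..l * d + r} = no_exceedance t {1..r}"
    and d: "d \<ge> 1" and \<theta>: "0 < \<theta>" "\<theta> \<le> 1" and k: "k \<ge> 1"
    and n: "2 * (k * d) \<le> n" "real (q n) \<le> real n / (4 * real k)"
  defines "b \<equiv> no_exceedance (x n) {1..n}" and "f \<equiv> 1 - F (x n)"
    and "e \<equiv> aim_coeff M X x q n + 2 * (real (q n) * (1 - F (x n)))"
  obtains a where "a \<in> {0..1}" "\<bar>a - b\<bar> \<le> real k * e + real (k * d) * f"
    "\<bar>no_exceedance (x n) {1..nat \<lfloor>\<theta> * real n\<rfloor>} - a powr \<theta>\<bar>
      \<le> 2 * (real n * f) / real k + real (k * d) * f + real k * e"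
proof -
  let ?G = "\<lambda>m. no_exceedance (x n) {1..m}"
  define K where "K = k * d"
  define r where "r = d * (n div K)"
  define j where "j = nat \<lfloor>\<theta> * real k\<rfloor>"
  define m where "m = nat \<lfloor>\<theta> * real n\<rfloor>"
  have K: "K \<ge> 1" using d k by (simp add: K_def)
  have f: "f \<ge> 0" using F_le_1 by (simp add: f_def)
  have e: "e \<ge> 0" using F_le_1[of "x n"] aim_coeff_nonneg[of x q n] by (simp add: e_def)
  have kr: "k * r = K * (n div K)" by (simp add: r_def K_def)
  have kr_le: "k * r \<le> n" unfolding kr by simp
  have kr_gt: "n < k * r + K"
    using mult_div_mod_eq[of K n] mod_less_divisor[of K n] K unfolding kr by linarith
  have r_le: "real r \<le> real n / real k"
    using kr_le k by (simp add: field_simps flip: of_nat_mult)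
  have q_le: "2 * q n \<le> r"
  proof -
    have "real (k * (4 * q n)) \<le> real n" using n(2) k by (simp add: field_simps)
    then have "k * (4 * q n) \<le> n" by (simp only: of_nat_le_iff)
    also have "n < k * (2 * r)" using n(1) kr_gt by (simp add: K_def)
    finally have "4 * q n < 2 * r" by (simp only: mult_less_cancel1)
    then show ?thesis by simp
  qed
  have r1: "r \<ge> 1" using n(1) kr_gt K by (cases r) (auto simp: K_def)
  have j: "real j \<le> \<theta> * real k" "\<theta> * real k < real j + 1"
    using \<theta> by (auto simp: j_def; linarith)+
  have m: "real m \<le> \<theta> * real n" "\<theta> * real n < real m + 1"
    using \<theta> by (auto simp: m_def; linarith)+
  have jk: "j \<le> k"
  proof -
    have "\<theta> * real k \<le> real k" using \<theta> by (simp add: mult_left_le_one_le)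
    then show ?thesis using j by linarith
  qed
  have jr_n: "j * r \<le> n" using mult_right_mono[OF jk, of r] kr_le by linarith
  have shift_r: "no_exceedance (x n) {l * r + 1..l * r + r} = ?G r" for l
    using shift[of "x n" "l * (n div K)" r] by (simp add: r_def mult_ac)
  note blocks = no_exceedance_blocks[where x = x and n = n and q = q, OF shift_r r1 q_le]
  let ?g = "?G r"
  have g: "0 \<le> ?g" "?g \<le> 1" by (rule no_exceedance_bounds)+
  have Gn: "\<bar>?g ^ k - b\<bar> \<le> real k * e + real (k * d) * f"
  proof -
    have "?G (k * r) \<le> b + real (card ({1..n} - {1..k * r})) * f"
      unfolding b_def f_def using kr_le by (intro no_exceedance_subset_le) auto
    moreover have "real (card ({1..n} - {1..k * r})) * f \<le> real (k * d) * f"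
    proof (intro mult_right_mono f)
      have "{1..n} - {1..k * r} = {k * r + 1..n}" by auto
      then show "real (card ({1..n} - {1..k * r})) \<le> real (k * d)" 
        using kr_gt unfolding K_def[symmetric] by simp
    qed
    moreover have "b \<le> ?G (k * r)"
      unfolding b_def using kr_le by (intro no_exceedance_antimono) auto
    ultimately show ?thesis using blocks[OF kr_le] unfolding e_def by linarith
  qed
  have Gm: "\<bar>?G m - ?G (j * r)\<bar> \<le> (real n / real k + real (k * d)) * f"
  proof -
    have "real (j * r) \<le> \<theta> * real n"
    proof -
      have "real (j * r) \<le> \<theta> * real k * real r" using j by (simp add: mult_right_mono)
      also have "\<dots> = \<theta> * real (k * r)" by simp
      also have "\<dots> \<le> \<theta> * real n" using kr_le \<theta> by (intro mult_left_mono) linarith+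
      finally show ?thesis .
    qed
    then have jr: "j * r \<le> m" using m by linarith
    have "\<theta> * real n \<le> \<theta> * (real (k * r) + real K)"
      using kr_gt \<theta> by (intro mult_left_mono) linarith+
    also have "\<dots> = (\<theta> * real k) * real r + \<theta> * real K" by (simp add: algebra_simps)
    also have "\<dots> \<le> (real j + 1) * real r + 1 * real K"
      using j \<theta> by (intro add_mono mult_right_mono) auto
    finally have "real m \<le> real (j * r) + real r + real K"
      using m by (simp add: algebra_simps)
    then have mj: "real m - real (j * r) \<le> real n / real k + real (k * d)"
      using r_le by (simp add: K_def)
    have "?G (j * r) \<le> ?G m + real (card ({1..m} - {1..j * r})) * f"
      unfolding f_def using jr by (intro no_exceedance_subset_le) auto
    moreover have "real (card ({1..m} - {1..j * r})) * f \<le> (real n / real k + real (k * d)) * f"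
    proof (intro mult_right_mono f)
      have "{1..m} - {1..j * r} = {j * r + 1..m}" by auto
      then show "real (card ({1..m} - {1..j * r})) \<le> real n / real k + real (k * d)"
        using mj jr by (simp add: of_nat_diff)
    qed
    moreover have "?G m \<le> ?G (j * r)"
      using jr by (intro no_exceedance_antimono) auto
    ultimately show ?thesis by linarith
  qed
  have Gj: "\<bar>?G (j * r) - ?g ^ j\<bar> \<le> real k * e"
  proof -
    have "real j * e \<le> real k * e" using jk e by (intro mult_right_mono) auto
    then show ?thesis using blocks[OF jr_n] unfolding e_def by linarith
  qed
  have gj: "\<bar>?g ^ j - ?g powr (real k * \<theta>)\<bar> \<le> real n / real k * f"
  proof -
    have "\<bar>?g ^ j - ?g powr (real k * \<theta>)\<bar> \<le> 1 - ?g"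
      using j g by (intro power_powr_diff_le) (auto simp: mult.commute)
    also have "1 - ?g \<le> real r * f"
      using no_exceedance_subset_le[of "{1..r}" "{}" "x n"] by (simp add: f_def)
    also have "\<dots> \<le> real n / real k * f" using r_le f by (intro mult_right_mono)
    finally show ?thesis .
  qed
  show ?thesis
  proof (rule that)
    show "?g ^ k \<in> {0..1}" using g by (simp add: power_le_one)
    show "\<bar>?g ^ k - b\<bar> \<le> real k * e + real (k * d) * f" by (rule Gn)
    have "\<bar>?G m - (?g ^ k) powr \<theta>\<bar>
      \<le> (real n / real k + real (k * d)) * f + real k * e + real n / real k * f"
      unfolding power_powr_eq[OF g(1) k] using Gm Gj gj by linarith
    then show "\<bar>?G (nat \<lfloor>\<theta> * real n\<rfloor>) - (?g ^ k) powr \<theta>\<bar>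
      \<le> 2 * (real n * f) / real k + real (k * d) * f + real k * e"
      by (simp add: m_def algebra_simps)
  qed
qed

text \<open>For fixed \<open>k\<close> the bounds of \<open>fraction_close_to_blocks\<close> tend to
  \<open>2 * \<tau> / k\<close> as \<open>n\<close> grows, and \<open>k\<close> is arbitrary.\<close>

lemma no_exceedance_fraction_powr:
  fixes x :: "nat \<Rightarrow> real" and \<tau> \<theta> :: real and q :: "nat \<Rightarrow> nat"
  assumes per: "periodic_dependence M X" and aim: "AIM_with M X x q"
    and nF: "(\<lambda>n. real n * (1 - F (x n))) \<longlonglongrightarrow> \<tau>" and \<theta>: "0 < \<theta>" "\<theta> \<le> 1"
  shows "(\<lambda>n. no_exceedance (x n) {1..nat \<lfloor>\<theta> * real n\<rfloor>} - no_exceedance (x n) {1..n} powr \<theta>)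
    \<longlonglongrightarrow> 0"
proof -
  define b where "b n = no_exceedance (x n) {1..n}" for n
  define f where "f n = 1 - F (x n)" for n
  define e where "e n = aim_coeff M X x q n + 2 * (real (q n) * f n)" for n
  from per obtain d where d: "d \<ge> 1" and "\<And>k t. \<forall>i\<in>{1..k}. t i \<ge> 1 \<Longrightarrow>
        distr M (\<Pi>\<^sub>M i\<in>{1..k}. borel) (\<lambda>\<omega>. \<lambda>i\<in>{1..k}. X (t i) \<omega>) =
        distr M (\<Pi>\<^sub>M i\<in>{1..k::nat}. borel) (\<lambda>\<omega>. \<lambda>i\<in>{1..k}. X (t i + d) \<omega>)"
    unfolding periodic_dependence_def by blast
  note shift = no_exceedance_shift[OF this(2)]
  have q0: "(\<lambda>n. real (q n) / real n) \<longlonglongrightarrow> 0"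
    using aim unfolding AIM_with_def by (auto dest: smalloD_tendsto)
  have f0: "f \<longlonglongrightarrow> 0"
  proof (rule Lim_transform_eventually)
    show "(\<lambda>n. (real n * f n) * (1 / real n)) \<longlonglongrightarrow> 0"
      using tendsto_mult[OF nF lim_1_over_n] by (simp add: f_def)
    show "eventually (\<lambda>n. (real n * f n) * (1 / real n) = f n) sequentially"
      using eventually_gt_at_top[of 0] by eventually_elim simp
  qed
  have "(\<lambda>n. real (q n) * f n) \<longlonglongrightarrow> 0"
  proof (rule Lim_transform_eventually)
    show "(\<lambda>n. (real (q n) / real n) * (real n * f n)) \<longlonglongrightarrow> 0"
      using tendsto_mult[OF q0 nF] by (simp add: f_def)
    show "eventually (\<lambda>n. (real (q n) / real n) * (real n * f n) = real (q n) * f n) sequentially"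
      using eventually_gt_at_top[of 0] by eventually_elim simp
  qed
  with aim have e0: "e \<longlonglongrightarrow> 0"
    unfolding e_def AIM_with_def by (auto intro!: tendsto_add_zero tendsto_mult_right_zero)
  show ?thesis
    unfolding b_def[symmetric] LIMSEQ_iff
  proof (intro allI impI)
    fix \<epsilon> :: real
    assume \<epsilon>: "\<epsilon> > 0"
    \<comment> \<open>Enough blocks for the part of the error that does not vanish to fall below \<open>\<epsilon>\<close>.\<close>
    obtain k :: nat where k: "k \<ge> 1" "2 * \<tau> / real k < \<epsilon>"
    proof
      show "nat \<lceil>2 * \<tau> / \<epsilon>\<rceil> + 1 \<ge> 1" by simp
      have "2 * \<tau> / \<epsilon> < real (nat \<lceil>2 * \<tau> / \<epsilon>\<rceil> + 1)" by linarith
      then show "2 * \<tau> / real (nat \<lceil>2 * \<tau> / \<epsilon>\<rceil> + 1) < \<epsilon>"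
        using \<epsilon> by (simp add: field_simps)
    qed
    have q_ev: "eventually (\<lambda>n. real (q n) \<le> real n / (4 * real k)) sequentially"
    proof -
      have "eventually (\<lambda>n. real (q n) / real n < 1 / (4 * real k)) sequentially"
        using k by (intro order_tendstoD(2)[OF q0]) auto
      then show ?thesis
        using eventually_gt_at_top[of 0] by eventually_elim (use k in \<open>simp add: field_simps\<close>)
    qed
    \<comment> \<open>For the finitely many \<open>n\<close> that are too small for \<open>k\<close> blocks any value in the unit interval serves.\<close>
    have "\<exists>a. a \<in> {0..1} \<and> (2 * (k * d) \<le> n \<longrightarrow> real (q n) \<le> real n / (4 * real k) \<longrightarrow>
      \<bar>a - b n\<bar> \<le> real k * e n + real (k * d) * f n \<and>
      \<bar>no_exceedance (x n) {1..nat \<lfloor>\<theta> * real n\<rfloor>} - a powr \<theta>\<bar>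
      \<le> 2 * (real n * f n) / real k + real (k * d) * f n + real k * e n)" for n
    proof (cases "2 * (k * d) \<le> n \<and> real (q n) \<le> real n / (4 * real k)")
      case True
      then show ?thesis
        using fraction_close_to_blocks[where x = x and n = n and q = q,
          OF shift d \<theta> k(1)] unfolding b_def e_def f_def by metis
    qed (auto intro: exI[of _ 0])
    then obtain a where a01: "\<And>n. a n \<in> {0..1}"
      and a_imp: "\<And>n. 2 * (k * d) \<le> n \<Longrightarrow> real (q n) \<le> real n / (4 * real k) \<Longrightarrow>
      \<bar>a n - b n\<bar> \<le> real k * e n + real (k * d) * f n \<and>
      \<bar>no_exceedance (x n) {1..nat \<lfloor>\<theta> * real n\<rfloor>} - a n powr \<theta>\<bar>
      \<le> 2 * (real n * f n) / real k + real (k * d) * f n + real k * e n"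
      by metis
    have a: "eventually (\<lambda>n. \<bar>a n - b n\<bar> \<le> real k * e n + real (k * d) * f n \<and>
      \<bar>no_exceedance (x n) {1..nat \<lfloor>\<theta> * real n\<rfloor>} - a n powr \<theta>\<bar>
      \<le> 2 * (real n * f n) / real k + real (k * d) * f n + real k * e n) sequentially"
      using q_ev eventually_ge_at_top[of "2 * (k * d)"]
      by eventually_elim (rule a_imp)
    have "(\<lambda>n. a n - b n) \<longlonglongrightarrow> 0"
    proof (rule Lim_null_comparison)
      show "eventually (\<lambda>n. norm (a n - b n) \<le> real k * e n + real (k * d) * f n) sequentially"
        using a by eventually_elim simp
      show "(\<lambda>n. real k * e n + real (k * d) * f n) \<longlonglongrightarrow> 0"
        using e0 f0 by (auto intro!: tendsto_eq_intros)
    qed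
    then have ab: "(\<lambda>n. a n powr \<theta> - b n powr \<theta>) \<longlonglongrightarrow> 0"
      using a01 no_exceedance_bounds by (intro tendsto_powr_diff[OF \<theta>(1)]) (auto simp: b_def)
    have "(\<lambda>n. 2 * (real n * f n) / real k + real (k * d) * f n + real k * e n
      + \<bar>a n powr \<theta> - b n powr \<theta>\<bar>) \<longlonglongrightarrow> 2 * \<tau> / real k + real (k * d) * 0 + real k * 0 + 0"
      using nF k unfolding f_def[symmetric]
      by (intro tendsto_intros f0 e0 tendsto_rabs_zero ab) auto
    then have "eventually (\<lambda>n. 2 * (real n * f n) / real k + real (k * d) * f n + real k * e n
      + \<bar>a n powr \<theta> - b n powr \<theta>\<bar> < \<epsilon>) sequentially"
      using k by (intro order_tendstoD) auto
    with a have "eventually (\<lambda>n. norm (no_exceedance (x n) {1..nat \<lfloor>\<theta> * real n\<rfloor>} - b n powr \<theta> - 0) < \<epsilon>)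
        sequentially"
      by eventually_elim (simp, linarith)
    then show "\<exists>N. \<forall>n\<ge>N. norm (no_exceedance (x n) {1..nat \<lfloor>\<theta> * real n\<rfloor>} - b n powr \<theta> - 0) < \<epsilon>"
      by (simp add: eventually_sequentially)
  qed
qed

text \<open>The union bound for all of \<open>{1..n}\<close> would give only \<open>1 - \<tau>\<close>. Applied to one
  \<open>k\<close>-th of the indices it loses less and less: \<open>b powr (1 / k) \<ge> 1 - \<tau> / k\<close> up to a
  null sequence, and \<open>(1 - \<tau> / k) ^ k\<close> tends to \<open>exp (- \<tau>)\<close>.\<close>

lemma liminf_no_exceedance_ge:
  fixes x :: "nat \<Rightarrow> real" and \<tau> :: real
  assumes per: "periodic_dependence M X" and aim: "AIM_with M X x q"
    and nF: "(\<lambda>n. real n * (1 - F (x n))) \<longlonglongrightarrow> \<tau>"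
  shows "ereal (exp (- \<tau>)) \<le> liminf (\<lambda>n. ereal (no_exceedance (x n) {1..n}))"
  unfolding le_Liminf_iff
proof (intro allI impI)
  fix c
  assume "c < ereal (exp (- \<tau>))"
  then have "max 0 c < ereal (exp (- \<tau>))" by simp
  then obtain c' where c': "max 0 c < ereal c'" "c' < exp (- \<tau>)"
    using ereal_dense2 less_ereal.simps(1) by blast
  have c'0: "c' > 0" using c'(1) by (simp add: zero_ereal_def)
  have "eventually (\<lambda>k. c' < (1 + (- \<tau>) / real k) ^ k) sequentially"
    using tendsto_exp_limit_sequentially[of "- \<tau>"] c' by (intro order_tendstoD) auto
  moreover have "eventually (\<lambda>k. 0 < 1 + (- \<tau>) * (1 / real k)) sequentially"
    by (rule order_tendstoD(1)[of _ 1]) (auto intro!: tendsto_eq_intros lim_1_over_n)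
  ultimately have "eventually (\<lambda>k. c' < (1 + (- \<tau>) / real k) ^ k \<and> 0 < 1 - \<tau> / real k \<and> k \<ge> 1) sequentially"
    using eventually_ge_at_top[of 1] by eventually_elim simp
  then obtain k :: nat where k: "c' < (1 - \<tau> / real k) ^ k" "0 < 1 - \<tau> / real k" "k \<ge> 1"
    by (auto simp: eventually_sequentially)
  let ?\<theta> = "1 / real k"
  let ?b = "\<lambda>n. no_exceedance (x n) {1..n}"
  let ?h = "\<lambda>n. no_exceedance (x n) {1..nat \<lfloor>?\<theta> * real n\<rfloor>}"
  have "c' powr ?\<theta> < ((1 - \<tau> / real k) ^ k) powr ?\<theta>"
    using k c'0 by (intro powr_less_mono2) auto
  also have "\<dots> = 1 - \<tau> / real k"
    using k by (subst power_powr_eq) auto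
  finally have lt: "c' powr ?\<theta> < 1 - \<tau> * ?\<theta>" by simp
  have h: "1 - ?\<theta> * (real n * (1 - F (x n))) \<le> ?h n" for n
  proof -
    have "1 \<le> ?h n + real (nat \<lfloor>?\<theta> * real n\<rfloor>) * (1 - F (x n))"
      using no_exceedance_subset_le[of "{1..nat \<lfloor>?\<theta> * real n\<rfloor>}" "{}" "x n"] by simp
    also have "real (nat \<lfloor>?\<theta> * real n\<rfloor>) * (1 - F (x n)) \<le> (?\<theta> * real n) * (1 - F (x n))"
      using F_le_1[of "x n"] by (intro mult_right_mono) auto
    finally show ?thesis by simp
  qed
  have "(\<lambda>n. 1 - ?\<theta> * (real n * (1 - F (x n))) - (?h n - ?b n powr ?\<theta>)) \<longlonglongrightarrow> 1 - ?\<theta> * \<tau> - 0"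
    using k by (intro tendsto_intros nF no_exceedance_fraction_powr[OF per aim nF]) auto
  then have "eventually (\<lambda>n. c' powr ?\<theta> < 1 - ?\<theta> * (real n * (1 - F (x n))) - (?h n - ?b n powr ?\<theta>)) sequentially"
    using lt by (intro order_tendstoD) (auto simp: mult.commute)
  then show "eventually (\<lambda>n. c < ereal (?b n)) sequentially"
  proof eventually_elim
    case (elim n)
    then have "c' powr ?\<theta> < ?b n powr ?\<theta>" using h[of n] by linarith
    then have "c' < ?b n"
      using powr_mono2[of ?\<theta> "?b n" c'] no_exceedance_bounds[of "x n" "{1..n}"] k
      by (simp add: not_le[symmetric]) (metis not_le)
    then show ?case using c'(1) by (metis ereal_less(2) less_ereal.simps(1) max_less_iff_conj order_less_trans)
  qed
qed

text \<open>With \<open>m = \<lfloor>\<tau>' n / \<tau>\<rfloor>\<close>, the level \<open>x n\<close> is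
  crossed among \<open>m\<close> variables with the same expected number of crossings \<open>\<tau>'\<close>, in the limit, as the level
  \<open>y m\<close>. This transfers the fractional power law from \<open>x\<close> to \<open>y\<close>, along all values of \<open>m\<close>.\<close>

lemma limsup_liminf_no_exceedance_level:
  fixes x y :: "nat \<Rightarrow> real" and \<tau> \<tau>' :: real
  assumes per: "periodic_dependence M X" and aim: "AIM_with M X x q"
    and nF: "(\<lambda>n. real n * (1 - F (x n))) \<longlonglongrightarrow> \<tau>"
    and nF': "(\<lambda>n. real n * (1 - F (y n))) \<longlonglongrightarrow> \<tau>'" and \<tau>': "0 < \<tau>'" "\<tau>' \<le> \<tau>"
    and lims: "limsup (\<lambda>n. ereal (no_exceedance (x n) {1..n})) = ereal u" "u \<in> {0..1}"
      "liminf (\<lambda>n. ereal (no_exceedance (x n) {1..n})) = ereal l" "l \<in> {0..1}"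
  shows "limsup (\<lambda>n. ereal (no_exceedance (y n) {1..n})) = ereal (u powr (\<tau>' / \<tau>))"
    and "liminf (\<lambda>n. ereal (no_exceedance (y n) {1..n})) = ereal (l powr (\<tau>' / \<tau>))"
proof -
  define \<theta> where "\<theta> = \<tau>' / \<tau>"
  have \<theta>: "0 < \<theta>" "\<theta> \<le> 1" using \<tau>' by (auto simp: \<theta>_def)
  define m where "m n = nat \<lfloor>\<theta> * real n\<rfloor>" for n
  let ?b = "\<lambda>n. no_exceedance (x n) {1..n}"
  let ?a = "\<lambda>n. no_exceedance (y n) {1..n}"
  have m_lim: "filterlim m sequentially sequentially"
    unfolding m_def filterlim_def filtermap_floor_mult[OF \<theta>] by simp
  have m_ratio: "(\<lambda>n. real (m n) / real n) \<longlonglongrightarrow> \<theta>"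
  proof (rule tendsto_sandwich)
    show "(\<lambda>n. \<theta> - 1 / real n) \<longlonglongrightarrow> \<theta>"
      using tendsto_diff[OF tendsto_const lim_1_over_n, of \<theta>] by simp
    show "eventually (\<lambda>n. \<theta> - 1 / real n \<le> real (m n) / real n) sequentially"
      using eventually_gt_at_top[of 0]
    proof eventually_elim
      case (elim n)
      have "\<theta> * real n - 1 \<le> real (m n)" unfolding m_def by linarith
      then have "(\<theta> * real n - 1) / real n \<le> real (m n) / real n" by (rule divide_right_mono) simp
      then show ?case using elim by (simp add: diff_divide_distrib)
    qed
    show "eventually (\<lambda>n. real (m n) / real n \<le> \<theta>) sequentially"
      using eventually_gt_at_top[of 0]
    proof eventually_elim
      case (elim n)
      have "real (m n) \<le> \<theta> * real n" using \<theta> unfolding m_def by simp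
      then show ?case using elim by (simp add: field_simps)
    qed
  qed simp
  have level: "(\<lambda>n. no_exceedance (y (m n)) {1..m n} - no_exceedance (x n) {1..m n}) \<longlonglongrightarrow> 0"
  proof (rule Lim_null_comparison)
    show "eventually (\<lambda>n. norm (no_exceedance (y (m n)) {1..m n} - no_exceedance (x n) {1..m n})
      \<le> \<bar>real (m n) * (1 - F (y (m n))) - (real (m n) / real n) * (real n * (1 - F (x n)))\<bar>) sequentially"
      using eventually_gt_at_top[of 0]
    proof eventually_elim
      case (elim n)
      have "norm (no_exceedance (y (m n)) {1..m n} - no_exceedance (x n) {1..m n})
          \<le> real (m n) * \<bar>F (y (m n)) - F (x n)\<bar>"
        using no_exceedance_level_dist[of "{1..m n}" "y (m n)" "x n"] by simp
      also have "\<dots> = \<bar>real (m n) * (1 - F (y (m n))) - real (m n) * (1 - F (x n))\<bar>"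
        by (simp add: abs_mult abs_minus_commute flip: right_diff_distrib)
      finally show ?case using elim by simp
    qed
    have "(\<lambda>n. \<bar>real (m n) * (1 - F (y (m n))) - (real (m n) / real n) * (real n * (1 - F (x n)))\<bar>)
      \<longlonglongrightarrow> \<bar>\<tau>' - \<theta> * \<tau>\<bar>"
      by (intro tendsto_intros m_ratio nF filterlim_compose[OF nF' m_lim])
    then show "(\<lambda>n. \<bar>real (m n) * (1 - F (y (m n))) - (real (m n) / real n) * (real n * (1 - F (x n)))\<bar>)
      \<longlonglongrightarrow> 0"
      using \<tau>' by (simp add: \<theta>_def)
  qed
  define \<delta> where "\<delta> n = ?a (m n) - ?b n powr \<theta>" for n
  have "\<delta> \<longlonglongrightarrow> 0 + 0"
    using tendsto_add[OF level no_exceedance_fraction_powr[OF per aim nF \<theta>]]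
    by (simp add: \<delta>_def[abs_def] m_def)
  then have \<delta>: "(\<lambda>n. ereal (\<delta> n)) \<longlonglongrightarrow> 0" by (simp add: zero_ereal_def)
  \<comment> \<open>A null sequence is added to the powers, which changes neither limit.\<close>
  have eq: "(\<lambda>n. ereal (?a (m n))) = (\<lambda>n. ereal (\<delta> n) + ereal (?b n powr \<theta>))"
    by (simp add: \<delta>_def)
  have b: "?b n \<in> {0..1}" for n using no_exceedance_bounds by simp
  note pow = limsup_liminf_powr[OF \<theta>(1) b lims(1,3,2,4)]
  have "limsup (\<lambda>n. ereal (?a (m n))) = ereal (u powr \<theta>)"
    unfolding eq using ereal_limsup_lim_add[OF \<delta>, of "\<lambda>n. ereal (?b n powr \<theta>)"] pow(1) by simp
  then show "limsup (\<lambda>n. ereal (?a n)) = ereal (u powr (\<tau>' / \<tau>))"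
    using limsup_liminf_floor_mult(1)[OF \<theta>, of "\<lambda>n. ereal (?a n)"] by (simp add: m_def \<theta>_def)
  have "liminf (\<lambda>n. ereal (?a (m n))) = ereal (l powr \<theta>)"
    unfolding eq using ereal_liminf_lim_add[OF \<delta>, of "\<lambda>n. ereal (?b n powr \<theta>)"] pow(2) by simp
  then show "liminf (\<lambda>n. ereal (?a n)) = ereal (l powr (\<tau>' / \<tau>))"
    using limsup_liminf_floor_mult(2)[OF \<theta>, of "\<lambda>n. ereal (?a n)"] by (simp add: m_def \<theta>_def)
qed

end

section \<open>The exponents\<close>

theorem theorem2p4:
  fixes M :: "'a measure" and X :: "nat \<Rightarrow> 'a \<Rightarrow> real" and F :: "real \<Rightarrow> real"
    and x :: "nat \<Rightarrow> real" and \<tau> :: real and q p :: "nat \<Rightarrow> nat"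
    and y :: "real \<Rightarrow> nat \<Rightarrow> real"
  assumes "prob_space M"
    and "\<And>i. i \<ge> 1 \<Longrightarrow> X i \<in> borel_measurable M"
    and "\<And>i. i \<ge> 1 \<Longrightarrow> cdf (distr M borel (X i)) = F"
    and "periodic_dependence M X"
    and "\<tau> > 0"
    and "(\<lambda>n. real n * (1 - F (x n))) \<longlonglongrightarrow> \<tau>"
    and "AIM_with M X x q"
    and "\<And>n. n \<ge> 1 \<Longrightarrow> p n > 0"
    and "(\<lambda>n. real (p n)) \<in> o(\<lambda>n. real n)"
    and "(\<lambda>n. real n * aim_coeff M X x q n) \<in> o(\<lambda>n. real (p n))"
    and "(\<lambda>n. real (q n)) \<in> o(\<lambda>n. real (p n))"
    and "\<And>\<tau>'. 0 < \<tau>' \<Longrightarrow> \<tau>' \<le> \<tau> \<Longrightarrow> (\<lambda>n. real n * (1 - F (y \<tau>' n))) \<longlonglongrightarrow> \<tau>'"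
  shows "\<exists>\<gamma> \<gamma>' :: real. 0 \<le> \<gamma> \<and> \<gamma> \<le> \<gamma>' \<and> \<gamma>' \<le> 1 \<and>
    (\<forall>\<tau>'. 0 < \<tau>' \<and> \<tau>' \<le> \<tau> \<longrightarrow>
       limsup (\<lambda>n. ereal (\<P>(\<omega> in M. max_over X {1..n} \<omega> \<le> y \<tau>' n))) = ereal (exp (- \<tau>' * \<gamma>)) \<and>
       liminf (\<lambda>n. ereal (\<P>(\<omega> in M. max_over X {1..n} \<omega> \<le> y \<tau>' n))) = ereal (exp (- \<tau>' * \<gamma>'))) \<and>
    ((\<exists>\<tau>'. 0 < \<tau>' \<and> \<tau>' \<le> \<tau> \<and> convergent (\<lambda>n. \<P>(\<omega> in M. max_over X {1..n} \<omega> \<le> y \<tau>' n))) \<longrightarrow>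
       \<gamma> = \<gamma>' \<and>
       (\<forall>\<tau>'. 0 < \<tau>' \<and> \<tau>' \<le> \<tau> \<longrightarrow>
          (\<lambda>n. \<P>(\<omega> in M. max_over X {1..n} \<omega> \<le> y \<tau>' n)) \<longlonglongrightarrow> exp (- \<tau>' * \<gamma>)))"
proof -
  interpret common_marginals M X F
    using assms(1-3) by (simp add: common_marginals_def common_marginals_axioms_def)
  let ?P = "\<lambda>\<tau>' n. \<P>(\<omega> in M. max_over X {1..n} \<omega> \<le> y \<tau>' n)"
  let ?b = "\<lambda>n. no_exceedance (x n) {1..n}"
  \<comment> \<open>Only eventually: at \<open>n = 0\<close> the maximum is taken over the empty set.\<close>
  have P: "eventually (\<lambda>n. ?P \<tau>' n = no_exceedance (y \<tau>' n) {1..n}) sequentially" for \<tau>'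
    using eventually_ge_at_top[of 1] by eventually_elim (simp add: prob_max_over_le)
  have lo: "ereal (exp (- \<tau>)) \<le> liminf (\<lambda>n. ereal (?b n))"
    by (rule liminf_no_exceedance_ge[OF assms(4,7,6)])
  have mid: "liminf (\<lambda>n. ereal (?b n)) \<le> limsup (\<lambda>n. ereal (?b n))"
    by (rule Liminf_le_Limsup) simp
  have hi: "limsup (\<lambda>n. ereal (?b n)) \<le> 1"
    using no_exceedance_bounds by (intro Limsup_bounded) (auto simp: one_ereal_def)
  obtain l where l: "liminf (\<lambda>n. ereal (?b n)) = ereal l"
    using lo mid hi by (cases "liminf (\<lambda>n. ereal (?b n))") auto
  obtain u where u: "limsup (\<lambda>n. ereal (?b n)) = ereal u"
    using lo mid hi by (cases "limsup (\<lambda>n. ereal (?b n))") auto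
  have lu: "exp (- \<tau>) \<le> l" "l \<le> u" "u \<le> 1" using lo mid hi l u by auto
  then have pos: "0 < l" "0 < u" using exp_gt_zero[of "- \<tau>"] by linarith+
  define \<gamma> where "\<gamma> = - ln u / \<tau>"
  define \<gamma>' where "\<gamma>' = - ln l / \<tau>"
  have \<gamma>: "0 \<le> \<gamma>" "\<gamma> \<le> \<gamma>'" "\<gamma>' \<le> 1"
  proof -
    show "0 \<le> \<gamma>" using pos lu assms(5) by (simp add: \<gamma>_def divide_nonpos_pos)
    show "\<gamma> \<le> \<gamma>'" using pos lu assms(5) by (simp add: \<gamma>_def \<gamma>'_def divide_right_mono)
    have "- \<tau> \<le> ln l" using pos lu by (simp add: ln_ge_iff)
    then show "\<gamma>' \<le> 1" using assms(5) by (simp add: \<gamma>'_def field_simps)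
  qed
  have lims: "limsup (\<lambda>n. ereal (?P \<tau>' n)) = ereal (exp (- \<tau>' * \<gamma>))"
    "liminf (\<lambda>n. ereal (?P \<tau>' n)) = ereal (exp (- \<tau>' * \<gamma>'))" if "0 < \<tau>'" "\<tau>' \<le> \<tau>" for \<tau>'
  proof -
    note level = limsup_liminf_no_exceedance_level[OF assms(4,7,6) assms(12)[OF that] that u _ l]
    have ex: "exp (- \<tau>' * \<gamma>) = u powr (\<tau>' / \<tau>)" "exp (- \<tau>' * \<gamma>') = l powr (\<tau>' / \<tau>)"
      using pos by (simp_all add: \<gamma>_def \<gamma>'_def powr_def)
    have "limsup (\<lambda>n. ereal (?P \<tau>' n)) = limsup (\<lambda>n. ereal (no_exceedance (y \<tau>' n) {1..n}))"
      by (intro Limsup_eq eventually_mono[OF P]) simp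
    then show "limsup (\<lambda>n. ereal (?P \<tau>' n)) = ereal (exp (- \<tau>' * \<gamma>))"
      using level(1) lu pos ex by simp
    have "liminf (\<lambda>n. ereal (?P \<tau>' n)) = liminf (\<lambda>n. ereal (no_exceedance (y \<tau>' n) {1..n}))"
      by (intro Liminf_eq eventually_mono[OF P]) simp
    then show "liminf (\<lambda>n. ereal (?P \<tau>' n)) = ereal (exp (- \<tau>' * \<gamma>'))"
      using level(2) lu pos ex by simp
  qed
  have conv: "\<gamma> = \<gamma>' \<and> (\<forall>\<tau>'. 0 < \<tau>' \<and> \<tau>' \<le> \<tau> \<longrightarrow> ?P \<tau>' \<longlonglongrightarrow> exp (- \<tau>' * \<gamma>))"
    if "0 < \<sigma>" "\<sigma> \<le> \<tau>" "convergent (?P \<sigma>)" for \<sigma>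
  proof -
    from that(3) obtain c where "?P \<sigma> \<longlonglongrightarrow> c" by (auto simp: convergent_def)
    then have "(\<lambda>n. ereal (?P \<sigma> n)) \<longlonglongrightarrow> ereal c" by simp
    from lim_imp_Limsup[OF _ this] lim_imp_Liminf[OF _ this] lims[OF that(1,2)]
    have "exp (- \<sigma> * \<gamma>) = exp (- \<sigma> * \<gamma>')" by simp
    then have eq: "\<gamma> = \<gamma>'" using that by simp
    have "?P \<tau>' \<longlonglongrightarrow> exp (- \<tau>' * \<gamma>)" if "0 < \<tau>'" "\<tau>' \<le> \<tau>" for \<tau>'
    proof -
      have "(\<lambda>n. ereal (?P \<tau>' n)) \<longlonglongrightarrow> ereal (exp (- \<tau>' * \<gamma>))"
        using lims[OF that] eq by (intro Liminf_eq_Limsup) auto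
      then show ?thesis by simp
    qed
    with eq show ?thesis by blast
  qed
  show ?thesis using \<gamma> lims conv by blast
qed

end
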